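(* There is an absolute constant $c>0$ such that the following holds for every integer $n$ and every $\varepsilon\in(1/\sqrt n,1)$. Let $\mathrm{sk}$ and $\mathrm{est}$ be (possibly randomized) sketching and estimation algorithms for unweighted graphs on vertex set $[n]$. Suppose that for every such graph $G=([n],E)$, with probability at least $3/4$ (over the randomness of the two algorithms) we have $$\forall S\subset[n],\qquad \mathrm{est}(S,\mathrm{sk}(G))\in(1\pm\varepsilon)\cdot|\partial(S,\bar S)| .$$ Then the worst-case size of $\mathrm{sk}(G)$ is at least $c\,n/\varepsilon^2$ bits.
   Context: Graphs are undirected. For $S\subset[n]$, $\bar S=[n]\setminus S$ and $\partial(S,\bar S)=\{(u,v)\in E: u\in S, v\in\bar S\}$. The sketching algorithm maps a graph $G$ to a bit string $\mathrm{sk}(G)$; the estimation algorithm maps a query $S$ and a bit string to a real number, with no further access to $G$. The two algorithms have access to a common source of random bits. The worst-case size is the maximum length of $\mathrm{sk}(G)$ over all graphs $G$ on $[n]$ and all random choices. The notation $X\in(1\pm\varepsilon)Y$ means $(1-\varepsilon)Y\le X\le(1+\varepsilon)Y$. *)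

theory Defs
  imports "HOL-Probability.Probability"
begin

text \<open>
  A simple undirected graph on \<open>[n]\<close> is given by its symmetric, irreflexive edge relation,
  so an undirected edge is present in both orientations.
\<close>
definition graphs_on :: "nat \<Rightarrow> (nat \<times> nat) set set" where
  "graphs_on n = {E. E \<subseteq> {1..n} \<times> {1..n} \<and> sym E \<and> irrefl E}"

text \<open>
  Exactly one orientation of each edge between \<open>S\<close> and its complement leads out of \<open>S\<close>,
  so the cardinality of this set is the number of undirected edges crossing the cut.
\<close>
definition cut_edges :: "nat \<Rightarrow> (nat \<times> nat) set \<Rightarrow> nat set \<Rightarrow> (nat \<times> nat) set" where
  "cut_edges n E S = {(u, v) \<in> E. u \<in> S \<and> v \<in> {1..n} - S}"

text \<open>The common source of randomness: an infinite sequence of independent fair bits.\<close>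
definition random_bits :: "(nat \<Rightarrow> bool) measure" where
  "random_bits = (\<Pi>\<^sub>M i\<in>UNIV. measure_pmf (bernoulli_pmf (1/2)))"

text \<open>
  Both algorithms take the shared random bits as first argument. Beyond the query and the sketch
  (and the random bits), the estimator has no access to the graph.
\<close>
type_synonym sketch_alg = "(nat \<Rightarrow> bool) \<Rightarrow> (nat \<times> nat) set \<Rightarrow> bool list"
type_synonym estimate_alg = "(nat \<Rightarrow> bool) \<Rightarrow> nat set \<Rightarrow> bool list \<Rightarrow> real"

definition all_cuts_approx ::
  "nat \<Rightarrow> real \<Rightarrow> sketch_alg \<Rightarrow> estimate_alg \<Rightarrow> (nat \<times> nat) set \<Rightarrow> (nat \<Rightarrow> bool) \<Rightarrow> bool" where
  "all_cuts_approx n \<epsilon> sk est E \<omega> \<longleftrightarrow>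
     (\<forall>S \<subseteq> {1..n}. est \<omega> S (sk \<omega> E) \<in>
        {(1 - \<epsilon>) * real (card (cut_edges n E S)) .. (1 + \<epsilon>) * real (card (cut_edges n E S))})"

text \<open>
  No measurability is imposed on \<open>sk\<close> and \<open>est\<close>: a non-measurable set has measure \<open>0\<close> in
  Isabelle/HOL, so the bound below entails that the success event is measurable.
\<close>
definition cut_sketch :: "nat \<Rightarrow> real \<Rightarrow> sketch_alg \<Rightarrow> estimate_alg \<Rightarrow> bool" where
  "cut_sketch n \<epsilon> sk est \<longleftrightarrow>
     (\<forall>E \<in> graphs_on n. \<P>(\<omega> in random_bits. all_cuts_approx n \<epsilon> sk est E \<omega>) \<ge> 3/4)"

text \<open>The value is \<open>\<infinity>\<close> if the sketch lengths are unbounded, and a maximum otherwise.\<close>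
definition worst_case_size :: "nat \<Rightarrow> sketch_alg \<Rightarrow> enat" where
  "worst_case_size n sk =
     (SUP E \<in> graphs_on n. SUP \<omega> \<in> space random_bits. enat (length (sk \<omega> E)))"

end

theory Submission
  imports Defs
begin

text \<open>
  Fix random bits for which the sketch succeeds on at least three quarters of a family of graphs;
  two of these graphs with the same sketch have all cuts within a factor
  \<open>(1 + \<epsilon>) / (1 - \<epsilon>)\<close>. The family consists of disjoint unions of \<open>B\<close> bipartite graphs on
  \<open>k + k\<close> vertices, where \<open>k\<close> is of order \<open>1 / \<epsilon>\<^sup>2\<close>, so that \<open>B * k\<^sup>2\<close>, the number of free bits, is
  of order \<open>n / \<epsilon>\<^sup>2\<close>. If two blocks differ in a constant fraction of the \<open>k\<^sup>2\<close> possible edges, a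
  Khintchine-type bound on random signs yields a cut on which they differ by order
  \<open>k * sqrt k\<close>, which exceeds \<open>\<epsilon> * k\<^sup>2\<close>. Hence graphs with a common sketch lie in a Hamming ball
  of small radius, and there must be exponentially many sketches. When \<open>\<epsilon>\<close> is bounded
  below, subgraphs of a matching (\<open>k = 1\<close>) suffice, since even a factor approximation
  tells zero cuts from non-zero ones.
\<close>

section \<open>Rademacher sums indexed by subsets\<close>

text \<open>A subset \<open>T\<close> of \<open>R\<close> encodes a sign vector, so a sum over
  \<open>Pow R\<close> is \<open>2 ^ card R\<close> times an expectation over independent uniform
  signs.\<close>

definition pm :: "'a set \<Rightarrow> 'a \<Rightarrow> real" where
  "pm T j = (if j \<in> T then 1 else - 1)"

lemma sum_Pow_insert:
  fixes g :: "'a set \<Rightarrow> 'b::comm_monoid_add"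
  assumes "finite R" "x \<notin> R"
  shows "(\<Sum>T\<in>Pow (insert x R). g T) = (\<Sum>T\<in>Pow R. g T + g (insert x T))"
proof -
  have inj: "inj_on (insert x) (Pow R)"
    using assms(2) by (auto simp: inj_on_def)
  have "(\<Sum>T\<in>Pow (insert x R). g T) = (\<Sum>T\<in>Pow R. g T) + (\<Sum>T\<in>insert x ` Pow R. g T)"
    unfolding Pow_insert using assms by (intro sum.union_disjoint) auto
  also have "(\<Sum>T\<in>insert x ` Pow R. g T) = (\<Sum>T\<in>Pow R. g (insert x T))"
    using inj by (simp add: sum.reindex)
  finally show ?thesis by (simp add: sum.distrib)
qed

lemma sum_pm_insert:
  assumes "finite R" "x \<notin> R" "T \<subseteq> R"
  shows "(\<Sum>j\<in>insert x R. a j * pm T j) = (\<Sum>j\<in>R. a j * pm T j) - a x"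
    and "(\<Sum>j\<in>insert x R. a j * pm (insert x T) j) = (\<Sum>j\<in>R. a j * pm T j) + a x"
proof -
  have "x \<notin> T" using assms by auto
  then show "(\<Sum>j\<in>insert x R. a j * pm T j) = (\<Sum>j\<in>R. a j * pm T j) - a x"
    using assms by (simp add: pm_def)
  have "(\<Sum>j\<in>R. a j * pm (insert x T) j) = (\<Sum>j\<in>R. a j * pm T j)"
    using assms by (intro sum.cong) (auto simp: pm_def)
  then show "(\<Sum>j\<in>insert x R. a j * pm (insert x T) j) = (\<Sum>j\<in>R. a j * pm T j) + a x"
    using assms by (simp add: pm_def)
qed

text \<open>Inserting \<open>x\<close> replaces each value \<open>X\<close> by the pair
  \<open>X + a x\<close> and \<open>X - a x\<close>; the cross terms of the two squares
  cancel.\<close>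

lemma second_moment_pm:
  assumes "finite R"
  shows "(\<Sum>T\<in>Pow R. (\<Sum>j\<in>R. a j * pm T j)\<^sup>2) = 2 ^ card R * (\<Sum>j\<in>R. (a j)\<^sup>2)"
  using assms
proof (induction R)
  case (insert x R)
  have "(\<Sum>T\<in>Pow (insert x R). (\<Sum>j\<in>insert x R. a j * pm T j)\<^sup>2)
      = (\<Sum>T\<in>Pow R. 2 * (\<Sum>j\<in>R. a j * pm T j)\<^sup>2 + 2 * (a x)\<^sup>2)"
    unfolding sum_Pow_insert[OF insert.hyps]
    by (intro sum.cong refl) (simp only: Pow_iff sum_pm_insert[OF insert.hyps], algebra)
  also have "\<dots> = 2 * (2 ^ card R * (\<Sum>j\<in>R. (a j)\<^sup>2)) + 2 ^ card R * (2 * (a x)\<^sup>2)"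
    using insert by (simp add: sum.distrib sum_distrib_left[symmetric] card_Pow)
  finally show ?case
    using insert.hyps by (simp add: algebra_simps)
qed simp

lemma fourth_moment_pm:
  assumes "finite R"
  shows "(\<Sum>T\<in>Pow R. (\<Sum>j\<in>R. a j * pm T j) ^ 4) \<le> 2 ^ card R * (3 * (\<Sum>j\<in>R. (a j)\<^sup>2)\<^sup>2)"
  using assms
proof (induction R)
  case (insert x R)
  let ?m = "\<Sum>j\<in>R. (a j)\<^sup>2" and ?X = "\<lambda>T. \<Sum>j\<in>R. a j * pm T j"
  have "(\<Sum>T\<in>Pow (insert x R). (\<Sum>j\<in>insert x R. a j * pm T j) ^ 4)
      = (\<Sum>T\<in>Pow R. 2 * ?X T ^ 4 + 12 * (a x)\<^sup>2 * (?X T)\<^sup>2 + 2 * (a x) ^ 4)"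
    unfolding sum_Pow_insert[OF insert.hyps]
    by (intro sum.cong refl) (simp only: Pow_iff sum_pm_insert[OF insert.hyps], algebra)
  also have "\<dots> = 2 * (\<Sum>T\<in>Pow R. ?X T ^ 4) + 12 * (a x)\<^sup>2 * (2 ^ card R * ?m)
      + 2 ^ card R * (2 * a x ^ 4)"
    using insert.hyps second_moment_pm[OF insert.hyps(1), of a]
    by (simp add: sum.distrib sum_distrib_left[symmetric] card_Pow)
  \<comment> \<open>Raising the coefficient 2 of \<open>a x ^ 4\<close> to 6 completes the square: 6
    m^2 + 12 m a^2 + 6 a^4 = 6 (m + a^2)^2.\<close>
  also have "\<dots> \<le> 2 * (2 ^ card R * (3 * ?m\<^sup>2)) + 12 * (a x)\<^sup>2 * (2 ^ card R * ?m)
      + 2 ^ card R * (6 * a x ^ 4)"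
    using insert.IH by (intro add_mono mult_left_mono) auto
  also have "\<dots> = 2 ^ card (insert x R) * (3 * (\<Sum>j\<in>insert x R. (a j)\<^sup>2)\<^sup>2)"
    using insert.hyps by simp algebra
  finally show ?case .
qed simp

text \<open>
  The bound \<open>2 * \<bar>x\<bar> * s ^ 3 \<ge> 3 * x\<^sup>2 * s\<^sup>2 - x ^ 4\<close> is
  \<open>(u - 1)\<^sup>2 * (u + 2) \<ge> 0\<close> for \<open>u = \<bar>x\<bar> / s\<close>; choosing the same scale \<open>s\<close> for all
  coefficient vectors makes the resulting lower bound linear in \<open>\<Sum>j\<in>R. (a j)\<^sup>2\<close>.
\<close>
lemma first_moment_pm:
  assumes "finite R" "R \<noteq> {}" and a: "\<And>j. j \<in> R \<Longrightarrow> \<bar>a j\<bar> \<le> 1"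
  shows "2 ^ card R * ((\<Sum>j\<in>R. (a j)\<^sup>2) / sqrt (3 * card R))
    \<le> (\<Sum>T\<in>Pow R. \<bar>\<Sum>j\<in>R. a j * pm T j\<bar>)"
proof -
  define s where "s = sqrt (3 * card R)"
  let ?m = "\<Sum>j\<in>R. (a j)\<^sup>2" and ?X = "\<lambda>T. \<Sum>j\<in>R. a j * pm T j"
  have s: "s > 0" "s\<^sup>2 = 3 * card R"
    using assms by (auto simp: s_def card_gt_0_iff)
  have m0: "?m \<ge> 0" by (intro sum_nonneg) auto
  have "?m \<le> (\<Sum>j\<in>R. 1)"
    using a by (intro sum_mono) (simp add: abs_square_le_1)
  then have m: "?m * 3 \<le> s\<^sup>2" by (simp add: s)
  have pt: "3 * x\<^sup>2 * s\<^sup>2 - x ^ 4 \<le> 2 * \<bar>x\<bar> * s ^ 3" for x :: real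
  proof -
    have "0 \<le> \<bar>x\<bar> * ((\<bar>x\<bar> - s)\<^sup>2 * (\<bar>x\<bar> + 2 * s))" using s by simp
    also have "\<dots> = \<bar>x\<bar> ^ 4 - 3 * \<bar>x\<bar>\<^sup>2 * s\<^sup>2 + 2 * \<bar>x\<bar> * s ^ 3" by algebra
    finally show ?thesis by simp
  qed
  \<comment> \<open>As 3 m is at most s^2, the fourth-moment term 3 m^2 uses up at most one of the
    three copies of s^2 m.\<close>
  have "2 * s\<^sup>2 * (2 ^ card R * ?m) \<le> 2 ^ card R * (3 * s\<^sup>2 * ?m - ?m * 3 * ?m)"
    using mult_right_mono[OF m m0] by (simp add: algebra_simps)
  also have "\<dots> = 3 * s\<^sup>2 * (2 ^ card R * ?m) - 2 ^ card R * (3 * ?m\<^sup>2)"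
    by algebra
  also have "\<dots> \<le> 3 * s\<^sup>2 * (\<Sum>T\<in>Pow R. (?X T)\<^sup>2) - (\<Sum>T\<in>Pow R. ?X T ^ 4)"
    using fourth_moment_pm[OF assms(1), of a] second_moment_pm[OF assms(1), of a] by simp
  also have "\<dots> = (\<Sum>T\<in>Pow R. 3 * (?X T)\<^sup>2 * s\<^sup>2 - ?X T ^ 4)"
    by (simp add: sum_subtractf sum_distrib_left mult_ac)
  also have "\<dots> \<le> (\<Sum>T\<in>Pow R. 2 * \<bar>?X T\<bar> * s ^ 3)"
    by (intro sum_mono pt)
  also have "\<dots> = 2 * s\<^sup>2 * (s * (\<Sum>T\<in>Pow R. \<bar>?X T\<bar>))"
    by (simp add: sum_distrib_left power3_eq_cube power2_eq_square mult_ac)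
  finally have "2 ^ card R * ?m \<le> s * (\<Sum>T\<in>Pow R. \<bar>?X T\<bar>)"
    by (rule mult_left_le_imp_le) (use s(1) in simp)
  then show ?thesis
    using s(1) unfolding s_def[symmetric] by (simp add: field_simps)
qed

text \<open>Averaging over column signs \<open>T\<close> gives one \<open>T\<close> for which the
  absolute row sums add up to at least their mean; the row signs \<open>U\<close> then remove the
  absolute values. A single \<open>T\<close> serves all rows because the first-moment bounds simply
  add up.\<close>

lemma ex_large_bilinear_form:
  assumes "finite I" "finite R" "R \<noteq> {}"
    and a: "\<And>i j. i \<in> I \<Longrightarrow> j \<in> R \<Longrightarrow> \<bar>a i j\<bar> \<le> 1"
  obtains U T where "U \<subseteq> I" "T \<subseteq> R"
    "(\<Sum>i\<in>I. \<Sum>j\<in>R. (a i j)\<^sup>2) / sqrt (3 * card R)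
      \<le> (\<Sum>i\<in>I. \<Sum>j\<in>R. a i j * (pm U i * pm T j))"
proof -
  let ?X = "\<lambda>i T. \<Sum>j\<in>R. a i j * pm T j"
  let ?c = "(\<Sum>i\<in>I. \<Sum>j\<in>R. (a i j)\<^sup>2) / sqrt (3 * card R)"
  have "\<exists>T\<in>Pow R. ?c \<le> (\<Sum>i\<in>I. \<bar>?X i T\<bar>)"
  proof (rule ccontr)
    assume "\<not> ?thesis"
    then have "(\<Sum>T\<in>Pow R. \<Sum>i\<in>I. \<bar>?X i T\<bar>) < (\<Sum>T\<in>Pow R. ?c)"
      using assms by (intro sum_strict_mono) (auto simp: not_le)
    also have "\<dots> = (\<Sum>i\<in>I. 2 ^ card R * ((\<Sum>j\<in>R. (a i j)\<^sup>2) / sqrt (3 * card R)))"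
      using assms by (simp add: card_Pow sum_distrib_left sum_divide_distrib)
    also have "\<dots> \<le> (\<Sum>i\<in>I. \<Sum>T\<in>Pow R. \<bar>?X i T\<bar>)"
      using assms by (intro sum_mono first_moment_pm) auto
    also have "\<dots> = (\<Sum>T\<in>Pow R. \<Sum>i\<in>I. \<bar>?X i T\<bar>)"
      by (rule sum.swap)
    finally show False by simp
  qed
  then obtain T where T: "T \<subseteq> R" "?c \<le> (\<Sum>i\<in>I. \<bar>?X i T\<bar>)" by auto
  define U where "U = {i \<in> I. ?X i T \<ge> 0}"
  have "(\<Sum>i\<in>I. \<bar>?X i T\<bar>) = (\<Sum>i\<in>I. pm U i * ?X i T)"
    by (intro sum.cong) (auto simp: U_def pm_def)
  also have "\<dots> = (\<Sum>i\<in>I. \<Sum>j\<in>R. a i j * (pm U i * pm T j))"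
    by (simp add: sum_distrib_left mult_ac)
  finally show thesis
    using T by (intro that[of U T]) (auto simp: U_def)
qed

section \<open>Hamming balls\<close>

lemma sum_power_card_Pow:
  fixes z :: real
  assumes "finite P"
  shows "(\<Sum>D\<in>Pow P. z ^ card D) = (1 + z) ^ card P"
  using assms
proof (induction P)
  case (insert x P)
  have "(\<Sum>D\<in>Pow (insert x P). z ^ card D) = (\<Sum>D\<in>Pow P. (1 + z) * z ^ card D)"
    unfolding sum_Pow_insert[OF insert.hyps]
  proof (intro sum.cong refl)
    fix D assume "D \<in> Pow P"
    then have "finite D" "x \<notin> D" using insert.hyps by (auto intro: finite_subset)
    then show "z ^ card D + z ^ card (insert x D) = (1 + z) * z ^ card D"
      by (simp add: algebra_simps)
  qed
  then show ?case
    using insert by (simp add: sum_distrib_left[symmetric])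
qed simp

text \<open>A Chernoff-type count: give \<open>D\<close> the weight \<open>(1 / 4) ^ card D\<close>.
  With N = \<open>card P\<close>, each \<open>D\<close> in the ball weighs at least 2^(-N/8), while
  all subsets together weigh (5/4)^N. As 125/64 < 2, this total is at most 2^(N/3), and 1/3 + 1/8 <
  1/2.\<close>

lemma card_hamming_ball_le:
  assumes "finite P"
  shows "real (card {D \<in> Pow P. 16 * card D \<le> card P}) \<le> 2 powr (card P / 2)"
proof -
  let ?N = "card P" and ?Q = "{D \<in> Pow P. 16 * card D \<le> card P}"
  have "real (card ?Q) * 2 powr (- (?N / 8)) = (\<Sum>D\<in>?Q. 2 powr (- (?N / 8)))"
    by simp
  also have "\<dots> \<le> (\<Sum>D\<in>?Q. (1 / 4) ^ card D)"
  proof (intro sum_mono)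
    fix D assume "D \<in> ?Q"
    then have "16 * real (card D) \<le> real ?N"
      by (metis (mono_tags, lifting) mem_Collect_eq of_nat_le_iff of_nat_mult of_nat_numeral)
    then have "2 powr (- (?N / 8)) \<le> (2::real) powr (- (2 * card D))"
      by (intro powr_mono) auto
    also have "\<dots> = (2 powr (- 2)) ^ card D"
      by (simp add: powr_realpow[symmetric] powr_powr)
    also have "\<dots> = (1 / 4 :: real) ^ card D"
      by (simp add: powr_minus)
    finally show "2 powr (- (?N / 8)) \<le> (1 / 4 :: real) ^ card D" .
  qed
  also have "\<dots> \<le> (\<Sum>D\<in>Pow P. (1 / 4) ^ card D)"
    using assms by (intro sum_mono2) auto
  also have "\<dots> = (5 / 4) ^ ?N"
    using sum_power_card_Pow[OF assms, of "1 / 4"] by simp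
  also have "\<dots> \<le> (2 powr (1 / 3)) ^ ?N"
  proof (rule power_mono)
    have "(5 / 4 :: real) ^ 3 \<le> (2 powr (1 / 3)) ^ 3"
      by (simp add: powr_realpow[symmetric] powr_powr power_divide)
    then show "5 / 4 \<le> (2::real) powr (1 / 3)"
      by (subst (asm) power_mono_iff) auto
  qed simp
  also have "\<dots> = 2 powr (?N / 3)"
    by (simp add: powr_realpow[symmetric] powr_powr)
  finally have "real (card ?Q) \<le> 2 powr (?N / 3) * 2 powr (?N / 8)"
    by (simp add: powr_minus field_simps)
  also have "\<dots> \<le> 2 powr (?N / 2)"
    unfolding powr_add[symmetric] by (intro powr_mono) auto
  finally show ?thesis .
qed

text \<open>A family of small diameter lies in a ball around any of its members; symmetric
  difference with that member moves the centre to the empty set injectively.\<close>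

lemma card_le_hamming_ball:
  assumes "finite P" "C \<subseteq> Pow P"
    and "\<And>A A'. A \<in> C \<Longrightarrow> A' \<in> C \<Longrightarrow> 16 * card (sym_diff A A') \<le> card P"
  shows "real (card C) \<le> 2 powr (card P / 2)"
proof (cases "C = {}")
  case False
  then obtain A0 where A0: "A0 \<in> C" by auto
  have "inj_on (\<lambda>A. sym_diff A A0) C"
    by (rule inj_onI) blast
  moreover have "(\<lambda>A. sym_diff A A0) ` C \<subseteq> {D \<in> Pow P. 16 * card D \<le> card P}"
    using assms A0 by auto
  ultimately have "card C \<le> card {D \<in> Pow P. 16 * card D \<le> card P}"
    using assms(1) by (intro card_inj_on_le) auto
  then show ?thesis
    using card_hamming_ball_le[OF assms(1)] by linarith
qed simp

section \<open>Counting sketches\<close>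

text \<open>The expected number of events that occur is at least \<open>p * card I\<close>, so some
  outcome attains this. It is used to fix the shared random bits.\<close>

lemma (in prob_space) ex_many_events:
  assumes "finite I" and "\<And>i. i \<in> I \<Longrightarrow> A i \<in> events" and "\<And>i. i \<in> I \<Longrightarrow> p \<le> prob (A i)"
  shows "\<exists>\<omega>\<in>space M. p * card I \<le> card {i \<in> I. \<omega> \<in> A i}"
proof (rule ccontr)
  assume neg: "\<not> ?thesis"
  let ?f = "\<lambda>\<omega>. \<Sum>i\<in>I. indicator (A i) \<omega> :: real"
  have f: "?f \<omega> = card {i \<in> I. \<omega> \<in> A i}" for \<omega>
    using assms(1) by (simp add: indicator_def sum.If_cases Int_def)
  have "integrable M ?f"
    using assms(2) by (intro Bochner_Integration.integrable_sum integrable_real_indicator)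
      (auto simp: emeasure_eq_measure)
  moreover have "AE \<omega> in M. ?f \<omega> < p * card I"
    using neg unfolding f by (intro AE_I2) (auto simp: not_le)
  ultimately have "expectation ?f < p * card I"
    by (rule expectation_less)
  moreover have "expectation ?f = (\<Sum>i\<in>I. prob (A i))"
    using assms(2) by (subst Bochner_Integration.integral_sum) (auto simp: emeasure_eq_measure)
  moreover have "p * card I \<le> (\<Sum>i\<in>I. prob (A i))"
    using sum_mono[of I "\<lambda>_. p", OF assms(3)] by (simp add: mult.commute)
  ultimately show False by simp
qed

lemma card_bool_lists_le: "card {xs :: bool list. length xs \<le> L} = 2 ^ (L + 1) - 1"
proof -
  have "card {xs :: bool list. length xs \<le> L} = (\<Sum>i\<le>L. 2 ^ i)"
    using card_lists_length_le[of "UNIV :: bool set" L] by simp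
  also have "\<dots> = 2 ^ (L + 1) - (1::nat)"
    by (induction L) auto
  finally show ?thesis .
qed

lemma finite_bool_lists_le: "finite {xs :: bool list. length xs \<le> L}"
  using finite_lists_length_le[of "UNIV :: bool set" L] by simp

text \<open>This is what remains when the common estimate is eliminated between the lower bound for
  \<open>E\<close> and the upper bound for \<open>E'\<close>. It is one-sided; a symmetric
  comparison takes both orders.\<close>

definition cut_close :: "nat \<Rightarrow> real \<Rightarrow> (nat \<times> nat) set \<Rightarrow> (nat \<times> nat) set \<Rightarrow> bool" where
  "cut_close n \<epsilon> E E' \<longleftrightarrow>
     (\<forall>S \<subseteq> {1..n}. (1 - \<epsilon>) * card (cut_edges n E S) \<le> (1 + \<epsilon>) * card (cut_edges n E' S))"

lemma prob_space_random_bits: "prob_space random_bits"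
  unfolding random_bits_def by (intro prob_space_PiM) (rule measure_pmf.prob_space_axioms)

text \<open>Pigeonhole: with the random bits fixed, the successful graphs are grouped by sketch.
  Graphs in one group share all estimates, hence are pairwise \<open>cut_close\<close>, and there
  are \<open>2 ^ (L + 1) - 1\<close> possible sketches.\<close>

lemma cut_sketch_counting:
  assumes sk: "cut_sketch n \<epsilon> sk est"
    and I: "finite I" "\<And>i. i \<in> I \<Longrightarrow> G i \<in> graphs_on n"
    and L: "\<And>i \<omega>. i \<in> I \<Longrightarrow> \<omega> \<in> space random_bits \<Longrightarrow> length (sk \<omega> (G i)) \<le> L"
    and V: "\<And>C. C \<subseteq> I \<Longrightarrow> (\<And>i j. i \<in> C \<Longrightarrow> j \<in> C \<Longrightarrow> cut_close n \<epsilon> (G i) (G j)) \<Longrightarrow>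
      real (card C) \<le> V"
  shows "3 / 4 * card I \<le> (2 ^ (L + 1) - 1) * V"
proof -
  interpret prob_space random_bits by (rule prob_space_random_bits)
  let ?A = "\<lambda>i. {\<omega> \<in> space random_bits. all_cuts_approx n \<epsilon> sk est (G i) \<omega>}"
  have p: "3 / 4 \<le> prob (?A i)" if "i \<in> I" for i
    using sk I(2)[OF that] by (auto simp: cut_sketch_def)
  \<comment> \<open>Measurability comes for free: a set outside the sigma-algebra has measure 0, not
    at least 3/4.\<close>
  then have "?A i \<in> events" if "i \<in> I" for i
    using that measure_notin_sets by fastforce
  from ex_many_events[OF I(1), of ?A, OF this p] obtain \<omega> where
    \<omega>: "\<omega> \<in> space random_bits" "3 / 4 * card I \<le> card {i \<in> I. \<omega> \<in> ?A i}"
    by (rule bexE)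
  let ?C = "\<lambda>s. {i \<in> I. \<omega> \<in> ?A i \<and> sk \<omega> (G i) = s}"
  let ?B = "{xs :: bool list. length xs \<le> L}"
  have C: "real (card (?C s)) \<le> V" for s
  proof (rule V)
    fix i j assume "i \<in> ?C s" "j \<in> ?C s"
    then have "all_cuts_approx n \<epsilon> sk est (G i) \<omega>" "all_cuts_approx n \<epsilon> sk est (G j) \<omega>"
      "sk \<omega> (G i) = sk \<omega> (G j)" by auto
    then show "cut_close n \<epsilon> (G i) (G j)"
      unfolding cut_close_def all_cuts_approx_def atLeastAtMost_iff by (metis order_trans)
  qed auto
  have "{i \<in> I. \<omega> \<in> ?A i} = (\<Union>s\<in>?B. ?C s)"
    using L \<omega>(1) by auto
  then have "card {i \<in> I. \<omega> \<in> ?A i} \<le> (\<Sum>s\<in>?B. card (?C s))"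
    by (simp only:) (rule card_UN_le[OF finite_bool_lists_le])
  then have "real (card {i \<in> I. \<omega> \<in> ?A i}) \<le> (\<Sum>s\<in>?B. real (card (?C s)))"
    by (simp flip: of_nat_sum)
  also have "\<dots> \<le> (\<Sum>s\<in>?B. V)"
    by (intro sum_mono C)
  also have "\<dots> = (2 ^ (L + 1) - 1) * V"
    by (simp add: card_bool_lists_le of_nat_diff)
  finally show ?thesis
    using \<omega>(2) by linarith
qed

section \<open>Disjoint unions of bipartite graphs\<close>

text \<open>
  The vertices \<open>{1..2 * k * B}\<close> are divided into \<open>2 * B\<close> consecutive groups of size \<open>k\<close>;
  groups \<open>2 * b\<close> and \<open>2 * b + 1\<close> are the two sides of the \<open>b\<close>-th bipartite block.
\<close>
definition vert :: "nat \<Rightarrow> nat \<Rightarrow> nat \<Rightarrow> nat" where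
  "vert k g i = Suc (k * g + i)"

definition slots :: "nat \<Rightarrow> nat \<Rightarrow> (nat \<times> nat \<times> nat) set" where
  "slots B k = {..<B} \<times> {..<k} \<times> {..<k}"

definition block_graph :: "nat \<Rightarrow> (nat \<times> nat \<times> nat) set \<Rightarrow> (nat \<times> nat) set" where
  "block_graph k A = {(u, v). \<exists>(b, i, j)\<in>A.
     u = vert k (2 * b) i \<and> v = vert k (2 * b + 1) j \<or>
     v = vert k (2 * b) i \<and> u = vert k (2 * b + 1) j}"

text \<open>A query inside block \<open>b\<close> alone: every other block lies wholly outside it
  and contributes no crossing edge.\<close>

definition block_cut :: "nat \<Rightarrow> nat \<Rightarrow> nat set \<Rightarrow> nat set \<Rightarrow> nat set" where
  "block_cut k b U T = vert k (2 * b) ` U \<union> vert k (2 * b + 1) ` T"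

lemma finite_slots: "finite (slots B k)"
  by (simp add: slots_def)

lemma card_slots: "card (slots B k) = B * k\<^sup>2"
  by (simp add: slots_def card_cartesian_product power2_eq_square)

lemma vert_inject:
  assumes "i < k" "j < k"
  shows "vert k g i = vert k h j \<longleftrightarrow> g = h \<and> i = j"
proof
  assume "vert k g i = vert k h j"
  then have eq: "k * g + i = k * h + j" by (simp add: vert_def)
  have "(k * g + i) div k = g" "(k * h + j) div k = h" using assms by auto
  with eq show "g = h \<and> i = j" by auto
qed simp

lemma vert_mem:
  assumes "i < k" "g < 2 * B" "2 * k * B \<le> n"
  shows "vert k g i \<in> {1..n}"
proof -
  have "vert k g i \<le> k * Suc g" using assms by (simp add: vert_def)
  also have "\<dots> \<le> k * (2 * B)" using assms by (intro mult_le_mono) auto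
  finally show ?thesis using assms by (simp add: vert_def)
qed

lemma block_graph_in_graphs_on:
  assumes "A \<subseteq> slots B k" "2 * k * B \<le> n"
  shows "block_graph k A \<in> graphs_on n"
proof -
  have *: "i < k \<and> j < k \<and> b < B" if "(b, i, j) \<in> A" for b i j
    using assms that by (auto simp: slots_def)
  have v: "vert k (2 * b) i \<in> {1..n}" "vert k (2 * b + 1) j \<in> {1..n}" if "(b, i, j) \<in> A" for b i j
    using *[OF that] by (auto intro!: vert_mem[OF _ _ assms(2)] simp del: atLeastAtMost_iff One_nat_def)
  have "block_graph k A \<subseteq> {1..n} \<times> {1..n}"
    unfolding block_graph_def using v by (auto simp del: atLeastAtMost_iff)
  moreover have "sym (block_graph k A)"
    unfolding block_graph_def sym_def by blast
  moreover have "2 * b \<noteq> 2 * b' + 1" for b b' :: nat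
    by presburger
  then have "irrefl (block_graph k A)"
    unfolding block_graph_def irrefl_def using * by (fastforce simp: vert_inject)
  ultimately show ?thesis by (simp add: graphs_on_def)
qed

text \<open>Each separated slot corresponds to the one orientation of its edge that leaves
  \<open>S\<close>; the disjoint numbering of the two sides makes this a bijection.\<close>

lemma card_cut_block_graph:
  assumes A: "A \<subseteq> slots B k" and n: "2 * k * B \<le> n"
  shows "card (cut_edges n (block_graph k A) S)
    = card {(b, i, j) \<in> A. (vert k (2 * b) i \<in> S) \<noteq> (vert k (2 * b + 1) j \<in> S)}"
proof -
  let ?l = "\<lambda>b i. vert k (2 * b) i" and ?r = "\<lambda>b j. vert k (2 * b + 1) j"
  let ?Q = "{(b, i, j) \<in> A. (?l b i \<in> S) \<noteq> (?r b j \<in> S)}"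
  let ?f = "\<lambda>(b, i, j). if ?l b i \<in> S then (?l b i, ?r b j) else (?r b j, ?l b i)"
  have *: "i < k \<and> j < k \<and> b < B" if "(b, i, j) \<in> A" for b i j
    using A that by (auto simp: slots_def)
  have v: "?l b i \<in> {1..n}" "?r b j \<in> {1..n}" if "(b, i, j) \<in> A" for b i j
    using *[OF that] by (auto intro!: vert_mem[OF _ _ n] simp del: atLeastAtMost_iff One_nat_def)
  have par: "2 * b \<noteq> 2 * b' + 1" "2 * b + 1 \<noteq> 2 * b'" for b b' :: nat
    by presburger+
  have "inj_on ?f ?Q"
  proof (rule inj_onI)
    fix x y assume xy: "x \<in> ?Q" "y \<in> ?Q" "?f x = ?f y"
    obtain b i j b' i' j' where eq: "x = (b, i, j)" "y = (b', i', j')"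
      by (metis prod_cases3)
    with xy * have "i < k" "j < k" "i' < k" "j' < k" by auto
    with xy(3) show "x = y"
      using par[of b b'] unfolding eq by (auto simp: vert_inject split: if_splits)
  qed
  moreover have "?f ` ?Q = cut_edges n (block_graph k A) S"
  proof
    show "?f ` ?Q \<subseteq> cut_edges n (block_graph k A) S"
      using v unfolding cut_edges_def block_graph_def
      by (auto simp del: atLeastAtMost_iff split: if_splits) blast+
    show "cut_edges n (block_graph k A) S \<subseteq> ?f ` ?Q"
    proof clarify
      fix u w assume "(u, w) \<in> cut_edges n (block_graph k A) S"
      then obtain b i j where q: "(b, i, j) \<in> A" "u \<in> S" "w \<notin> S"
        "u = ?l b i \<and> w = ?r b j \<or> w = ?l b i \<and> u = ?r b j"
        by (auto simp: cut_edges_def block_graph_def)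
      then have "(b, i, j) \<in> ?Q" "(u, w) = ?f (b, i, j)" by auto
      then show "(u, w) \<in> ?f ` ?Q" by (rule rev_image_eqI)
    qed
  qed
  ultimately have "bij_betw ?f ?Q (cut_edges n (block_graph k A) S)"
    by (rule bij_betw_imageI)
  then show ?thesis
    by (rule bij_betw_same_card[symmetric])
qed

text \<open>The factor \<open>(1 - pm U i * pm T j) / 2\<close> is the indicator that the endpoints
  \<open>i\<close> and \<open>j\<close> are on different sides, which makes the cut size affine in
  the bilinear form.\<close>

lemma card_block_cut:
  assumes A: "A \<subseteq> slots B k" and n: "2 * k * B \<le> n" and UT: "U \<subseteq> {..<k}" "T \<subseteq> {..<k}"
  shows "real (card (cut_edges n (block_graph k A) (block_cut k b U T)))
    = (\<Sum>i<k. \<Sum>j<k. of_bool ((b, i, j) \<in> A) * ((1 - pm U i * pm T j) / 2))"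
proof -
  let ?S = "block_cut k b U T"
  have par: "2 * c \<noteq> 2 * c' + 1" "2 * c + 1 \<noteq> 2 * c'" for c c' :: nat
    by presburger+
  have l: "vert k (2 * c) i \<in> ?S \<longleftrightarrow> c = b \<and> i \<in> U" if "i < k" for c i
    using that UT par[of c b] by (auto simp: block_cut_def vert_inject subset_iff image_iff)
  have r: "vert k (2 * c + 1) j \<in> ?S \<longleftrightarrow> c = b \<and> j \<in> T" if "j < k" for c j
    using that UT par[of c b] by (auto simp: block_cut_def vert_inject subset_iff image_iff)
  let ?R = "{(i, j) \<in> {..<k} \<times> {..<k}. (b, i, j) \<in> A \<and> (i \<in> U) \<noteq> (j \<in> T)}"
  have "{(c, i, j) \<in> A. (vert k (2 * c) i \<in> ?S) \<noteq> (vert k (2 * c + 1) j \<in> ?S)} = Pair b ` ?R"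
    using A l r by (auto simp: slots_def)
  then have "card (cut_edges n (block_graph k A) ?S) = card ?R"
    unfolding card_cut_block_graph[OF A n] by (simp add: card_image inj_on_def)
  also have "real (card ?R) = (\<Sum>(i, j)\<in>?R. 1)" by simp
  also have "\<dots> = (\<Sum>(i, j)\<in>{..<k} \<times> {..<k}. of_bool ((b, i, j) \<in> A) * ((1 - pm U i * pm T j) / 2))"
    by (intro sum.mono_neutral_cong_left) (auto simp: pm_def split: if_splits)
  also have "\<dots> = (\<Sum>i<k. \<Sum>j<k. of_bool ((b, i, j) \<in> A) * ((1 - pm U i * pm T j) / 2))"
    by (simp add: sum.cartesian_product)
  finally show ?thesis .
qed

section \<open>From closeness on all cuts to small Hamming distance\<close>

lemma block_cut_subset:
  assumes "b < B" "2 * k * B \<le> n" "U \<subseteq> {..<k}" "T \<subseteq> {..<k}"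
  shows "block_cut k b U T \<subseteq> {1..n}"
  using assms unfolding block_cut_def
  by (auto intro!: vert_mem simp: subset_iff simp del: atLeastAtMost_iff One_nat_def)

text \<open>The two one-sided comparisons bound the difference of the cut sizes by \<epsilon> times
  their sum, and each cut has at most k^2 edges.\<close>

lemma cut_close_block_form:
  assumes A: "A \<subseteq> slots B k" "A' \<subseteq> slots B k" and n: "2 * k * B \<le> n" and b: "b < B"
    and UT: "U \<subseteq> {..<k}" "T \<subseteq> {..<k}" and \<epsilon>: "0 \<le> \<epsilon>"
    and close: "cut_close n \<epsilon> (block_graph k A) (block_graph k A')"
      "cut_close n \<epsilon> (block_graph k A') (block_graph k A)"
  shows "\<bar>\<Sum>i<k. \<Sum>j<k. (of_bool ((b, i, j) \<in> A) - of_bool ((b, i, j) \<in> A')) *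
      ((1 - pm U i * pm T j) / 2)\<bar> \<le> 2 * \<epsilon> * (real k)\<^sup>2"
proof -
  let ?w = "\<lambda>i j. (1 - pm U i * pm T j) / 2 :: real"
  let ?c = "\<lambda>A. \<Sum>i<k. \<Sum>j<k. of_bool ((b, i, j) \<in> A) * ?w i j"
  have up: "?c X \<le> (real k)\<^sup>2" for X
  proof -
    have "?c X \<le> (\<Sum>i<k. \<Sum>j<k. 1)"
      by (intro sum_mono) (auto simp: pm_def)
    then show ?thesis by (simp add: power2_eq_square)
  qed
  have "(1 - \<epsilon>) * ?c A \<le> (1 + \<epsilon>) * ?c A'" "(1 - \<epsilon>) * ?c A' \<le> (1 + \<epsilon>) * ?c A"
    using close block_cut_subset[OF b n UT]
    unfolding cut_close_def card_block_cut[OF A(1) n UT, symmetric]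
      card_block_cut[OF A(2) n UT, symmetric] by auto
  then have "\<bar>?c A - ?c A'\<bar> \<le> \<epsilon> * (?c A + ?c A')"
    by (simp add: algebra_simps abs_le_iff)
  also have "\<dots> \<le> \<epsilon> * ((real k)\<^sup>2 + (real k)\<^sup>2)"
    by (intro mult_left_mono add_mono up \<epsilon>)
  finally show ?thesis
    unfolding left_diff_distrib sum_subtractf by simp
qed

text \<open>
  The cuts \<open>(U, T)\<close> and \<open>(- U, T)\<close> differ only in the sign of the bilinear form, so the
  contribution of the total number of edges cancels. The constant is \<open>12288 = 64\<^sup>2 * 3\<close>.
\<close>
lemma cut_close_block_distance:
  fixes \<epsilon> :: real
  assumes A: "A \<subseteq> slots B k" "A' \<subseteq> slots B k" and n: "2 * k * B \<le> n" and b: "b < B"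
    and \<epsilon>: "0 \<le> \<epsilon>" "12288 * \<epsilon>\<^sup>2 * k \<le> 1" and k: "k > 0"
    and close: "cut_close n \<epsilon> (block_graph k A) (block_graph k A')"
      "cut_close n \<epsilon> (block_graph k A') (block_graph k A)"
  shows "16 * (\<Sum>i<k. \<Sum>j<k. (of_bool ((b, i, j) \<in> A) - of_bool ((b, i, j) \<in> A') :: real)\<^sup>2)
    \<le> (real k)\<^sup>2"
proof -
  let ?d = "\<lambda>i j. of_bool ((b, i, j) \<in> A) - of_bool ((b, i, j) \<in> A') :: real"
  let ?m = "\<Sum>i<k. \<Sum>j<k. (?d i j)\<^sup>2"
  obtain U T where UT: "U \<subseteq> {..<k}" "T \<subseteq> {..<k}"
    and m: "?m / sqrt (3 * card {..<k}) \<le> (\<Sum>i<k. \<Sum>j<k. ?d i j * (pm U i * pm T j))"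
    using k by (elim ex_large_bilinear_form[of "{..<k}" "{..<k}" ?d, rotated -1]) auto
  let ?q = "\<Sum>i<k. \<Sum>j<k. ?d i j * (pm U i * pm T j)"
  let ?c = "\<lambda>U. \<Sum>i<k. \<Sum>j<k. ?d i j * ((1 - pm U i * pm T j) / 2)"
  have pmc: "pm ({..<k} - U) i = - pm U i" if "i < k" for i
    using that by (simp add: pm_def)
  have "?c ({..<k} - U) - ?c U = ?q"
    unfolding sum_subtractf[symmetric]
    by (intro sum.cong refl) (simp add: pmc field_simps)
  moreover have "\<bar>?c X\<bar> \<le> 2 * \<epsilon> * (real k)\<^sup>2" if "X \<subseteq> {..<k}" for X
    by (rule cut_close_block_form[OF A n b that UT(2) \<epsilon>(1) close])
  from this[of U] this[of "{..<k} - U"] UT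
  have "\<bar>?c U\<bar> \<le> 2 * \<epsilon> * (real k)\<^sup>2" "\<bar>?c ({..<k} - U)\<bar> \<le> 2 * \<epsilon> * (real k)\<^sup>2"
    by auto
  ultimately have "?q \<le> 4 * \<epsilon> * (real k)\<^sup>2" by linarith
  with m have "?m / sqrt (3 * real k) \<le> 4 * \<epsilon> * (real k)\<^sup>2" by simp
  \<comment> \<open>Here 64 = 16 * 4, the 4 coming from two cut errors of 2 \<epsilon> k^2 each. The
    bracket squares to 12288 \<epsilon>^2 k.\<close>
  then have "16 * ?m \<le> (64 * \<epsilon> * sqrt (3 * real k)) * (real k)\<^sup>2"
    using k by (simp add: field_simps)
  also have "\<dots> \<le> 1 * (real k)\<^sup>2"
  proof (rule mult_right_mono)
    have "(64 * \<epsilon> * sqrt (3 * real k))\<^sup>2 \<le> 1"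
      using \<epsilon> by (simp add: power_mult_distrib mult_ac)
    then show "64 * \<epsilon> * sqrt (3 * real k) \<le> 1"
      by (simp only: abs_square_le_1 abs_le_iff)
  qed simp
  finally show ?thesis by simp
qed

text \<open>Differences of indicators are -1, 0 or 1, so their squares count the symmetric
  difference; the block bounds are then summed.\<close>

lemma cut_close_hamming_distance:
  fixes \<epsilon> :: real
  assumes A: "A \<subseteq> slots B k" "A' \<subseteq> slots B k" and n: "2 * k * B \<le> n"
    and \<epsilon>: "0 \<le> \<epsilon>" "12288 * \<epsilon>\<^sup>2 * k \<le> 1" and k: "k > 0"
    and close: "cut_close n \<epsilon> (block_graph k A) (block_graph k A')"
      "cut_close n \<epsilon> (block_graph k A') (block_graph k A)"
  shows "16 * card (sym_diff A A') \<le> card (slots B k)"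
proof -
  have "real (card (sym_diff A A')) = (\<Sum>x\<in>sym_diff A A'. 1)" by simp
  also have "\<dots> = (\<Sum>x\<in>slots B k. (of_bool (x \<in> A) - of_bool (x \<in> A'))\<^sup>2)"
    using A finite_slots[of B k] by (intro sum.mono_neutral_cong_left) auto
  also have "\<dots> = (\<Sum>b<B. \<Sum>i<k. \<Sum>j<k. (of_bool ((b, i, j) \<in> A) - of_bool ((b, i, j) \<in> A'))\<^sup>2)"
    by (simp add: slots_def sum.cartesian_product case_prod_unfold)
  finally have "16 * real (card (sym_diff A A')) = (\<Sum>b<B. 16 *
      (\<Sum>i<k. \<Sum>j<k. (of_bool ((b, i, j) \<in> A) - of_bool ((b, i, j) \<in> A'))\<^sup>2))"
    by (simp only: sum_distrib_left)
  also have "\<dots> \<le> (\<Sum>b<B. (real k)\<^sup>2)"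
    by (intro sum_mono cut_close_block_distance[OF A n _ \<epsilon> k close]) auto
  also have "\<dots> = real (card (slots B k))"
    by (simp add: card_slots)
  finally show ?thesis
    by (metis of_nat_le_iff of_nat_mult of_nat_numeral)
qed

text \<open>Querying the left endpoint of one potential matching edge gives a cut of size 0 or 1,
  and for \<epsilon> < 1 size 1 cannot be close to size 0.\<close>

lemma cut_close_matching:
  assumes A: "A \<subseteq> slots B 1" "A' \<subseteq> slots B 1" and n: "2 * B \<le> n" and \<epsilon>: "\<epsilon> < 1"
    and close: "cut_close n \<epsilon> (block_graph 1 A) (block_graph 1 A')"
  shows "A \<subseteq> A'"
proof
  fix x assume x: "x \<in> A"
  then obtain b where b: "x = (b, 0, 0)" "b < B" using A by (auto simp: slots_def)
  let ?S = "block_cut 1 b {0} {}"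
  have n': "2 * 1 * B \<le> n" and S: "?S \<subseteq> {1..n}"
    using n b(2) block_cut_subset[of b B 1 n "{0}" "{}"] by auto
  have "real (card (cut_edges n (block_graph 1 X) ?S)) = of_bool (x \<in> X)" if "X \<subseteq> slots B 1" for X
    using card_block_cut[OF that n', of "{0}" "{}" b] by (simp add: b pm_def)
  with close S A have "(1 - \<epsilon>) * of_bool (x \<in> A) \<le> (1 + \<epsilon>) * of_bool (x \<in> A')"
    unfolding cut_close_def by metis
  with x \<epsilon> show "x \<in> A'" by (cases "x \<in> A'") auto
qed

section \<open>The lower bound\<close>

lemma sketch_length_large_eps:
  assumes sk: "cut_sketch n \<epsilon> sk est" and \<epsilon>: "\<epsilon> < 1" and n: "n \<ge> 2"
    and L: "\<And>E \<omega>. E \<in> graphs_on n \<Longrightarrow> \<omega> \<in> space random_bits \<Longrightarrow> length (sk \<omega> E) \<le> L"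
  shows "real n \<le> 6 * real L"
proof -
  define B where "B = n div 2"
  have B: "2 * B \<le> n" "n \<le> 3 * B" "B \<ge> 1" using n by (auto simp: B_def)
  have G: "block_graph 1 A \<in> graphs_on n" if "A \<in> Pow (slots B 1)" for A
    using that B(1) by (intro block_graph_in_graphs_on[of A B]) auto
  have "3 / 4 * card (Pow (slots B 1)) \<le> (2 ^ (L + 1) - 1) * (1::real)"
  proof (rule cut_sketch_counting[OF sk _ G])
    fix C assume C: "C \<subseteq> Pow (slots B 1)"
      "\<And>i j. i \<in> C \<Longrightarrow> j \<in> C \<Longrightarrow> cut_close n \<epsilon> (block_graph 1 i) (block_graph 1 j)"
    have "A = A'" if "A \<in> C" "A' \<in> C" for A A'
      using C that cut_close_matching[OF _ _ B(1) \<epsilon>] by (meson PowD subset_antisym subset_iff)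
    moreover have "finite C" using finite_subset[OF C(1)] finite_slots by simp
    ultimately have "card C \<le> Suc 0" by (subst card_le_Suc0_iff_eq) auto
    then show "real (card C) \<le> 1" by simp
  qed (use G L finite_slots in auto)
  then have *: "3 * 2 ^ B + 4 \<le> 4 * (2::real) ^ (L + 1)"
    by (simp add: card_Pow finite_slots card_slots)
  \<comment> \<open>For \<open>B = 1\<close> the exact count \<open>2 ^ (L + 1) - 1\<close> matters:
    \<open>L = 0\<close> would require 10 <= 8. For larger \<open>B\<close> one gets B <= L + 1,
    hence L >= 1 and B <= 2 L.\<close>
  have "B \<le> 2 * L"
  proof (cases "B = 1")
    case True
    with * have "L \<noteq> 0" by (intro notI) simp
    with True show ?thesis by simp
  next
    case False
    have "(2::real) ^ B < 2 ^ (L + 2)"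
    proof (rule ccontr)
      assume "\<not> ?thesis"
      then have "2 * (2::real) ^ (L + 1) \<le> 2 ^ B" by simp
      with * show False using zero_le_power[of "2::real" B] by linarith
    qed
    then have "B < L + 2" by (rule power_less_imp_less_exp[rotated]) simp
    with False B(3) show ?thesis by linarith
  qed
  with B(2) show ?thesis by linarith
qed

lemma sketch_length_small_eps:
  fixes \<epsilon> :: real
  assumes sk: "cut_sketch n \<epsilon> sk est"
    and \<epsilon>: "0 < \<epsilon>" "3 * 12288 * \<epsilon>\<^sup>2 \<le> 1" and n: "1 \<le> real n * \<epsilon>\<^sup>2"
    and L: "\<And>E \<omega>. E \<in> graphs_on n \<Longrightarrow> \<omega> \<in> space random_bits \<Longrightarrow> length (sk \<omega> E) \<le> L"
  shows "real n \<le> 32 * 12288 * \<epsilon>\<^sup>2 * real L"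
proof -
  \<comment> \<open>The largest real block size allowed by the distance bound; \<open>k\<close> is
    its integer part, so rounding loses at most a factor 2.\<close>
  define x where "x = 1 / (12288 * \<epsilon>\<^sup>2)"
  define k where "k = nat \<lfloor>x\<rfloor>"
  define B where "B = n div (2 * k)"
  have x: "3 \<le> x" "12288 * \<epsilon>\<^sup>2 * x = 1" "12288 * x \<le> n"
    using \<epsilon> n by (auto simp: x_def field_simps)
  have k: "real k \<le> x" "x \<le> 2 * real k" "3 \<le> k"
    using x(1) unfolding k_def by linarith+
  have "12288 * k \<le> n" using k(1) x(3) by linarith
  then have "2 * k \<le> n" by simp
  then have B1: "1 \<le> B" using k(3) unfolding B_def by (simp add: div_greater_zero_iff Suc_le_eq)
  have B: "2 * k * B \<le> n" unfolding B_def by simp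
  have "n < 2 * k * B + 2 * k" using k(3) unfolding B_def
    by (metis add.commute dividend_less_times_div mult_pos_pos not_less_eq_eq pos2 less_le_trans zero_less_numeral)
  also have "\<dots> \<le> 4 * k * B" using B1 mult_le_mono2[OF B1, of "2 * k"] by simp
  finally have nB: "real n \<le> 4 * real k * real B"
    by (metis less_imp_le of_nat_le_iff of_nat_mult of_nat_numeral)
  define N where "N = B * k\<^sup>2"
  have N9: "9 \<le> N"
    using mult_le_mono[OF B1 power_mono[OF k(3), of 2]] by (simp add: N_def)
  have \<epsilon>k: "12288 * \<epsilon>\<^sup>2 * real k \<le> 1"
    using mult_left_mono[OF k(1), of "12288 * \<epsilon>\<^sup>2"] x(2) by simp
  have G: "block_graph k A \<in> graphs_on n" if "A \<in> Pow (slots B k)" for A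
    using that B by (intro block_graph_in_graphs_on) auto
  have "3 / 4 * card (Pow (slots B k)) \<le> (2 ^ (L + 1) - 1) * 2 powr (card (slots B k) / 2)"
  proof (rule cut_sketch_counting[OF sk _ G])
    fix C assume C: "C \<subseteq> Pow (slots B k)"
      "\<And>i j. i \<in> C \<Longrightarrow> j \<in> C \<Longrightarrow> cut_close n \<epsilon> (block_graph k i) (block_graph k j)"
    show "real (card C) \<le> 2 powr (card (slots B k) / 2)"
    proof (rule card_le_hamming_ball[OF finite_slots C(1)])
      fix A A' assume "A \<in> C" "A' \<in> C"
      then show "16 * card (sym_diff A A') \<le> card (slots B k)"
        using C \<epsilon> k(3) by (intro cut_close_hamming_distance[OF _ _ B _ \<epsilon>k]) auto
    qed
  qed (use G L finite_slots in auto)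
  then have "3 / 4 * 2 powr N \<le> (2 ^ (L + 1) - 1) * 2 powr (N / 2)"
    by (simp add: card_Pow finite_slots card_slots N_def[symmetric] powr_realpow)
  also have "\<dots> \<le> 2 powr (L + 1) * 2 powr (N / 2)"
    by (intro mult_right_mono) (simp_all add: powr_realpow powr_add)
  also have "\<dots> = 2 powr (L + 1 + N / 2)"
    by (simp add: powr_add)
  finally have "3 / 4 * 2 powr N \<le> 2 powr (L + 1 + N / 2)" .
  \<comment> \<open>The factor 3/4 is weakened to 1/2, so that only exponents have to be
    compared.\<close>
  then have "2 powr (real N - 1) \<le> 2 powr (L + 1 + N / 2)"
    using powr_ge_zero[of 2 "real N"] by (simp only: powr_diff powr_one)
  then have "real N - 1 \<le> L + 1 + real N / 2"
    by simp
  \<comment> \<open>The comparison gives N <= 2 L + 4; the additive 4 is absorbed using N >= 9,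
    which rests on k >= 3.\<close>
  then have NL: "real N \<le> 4 * real L"
    using N9 by linarith
  \<comment> \<open>Multiplying \<open>n\<close> by \<open>12288 * \<epsilon>\<^sup>2 * x\<close>,
    which is 1, brings in the second factor \<open>k\<close>: n x is at most 4 k B * 2 k = 8
    N.\<close>
  have "real n = 12288 * \<epsilon>\<^sup>2 * (real n * x)" using x(2) by simp
  also have "\<dots> \<le> 12288 * \<epsilon>\<^sup>2 * ((4 * real k * real B) * (2 * real k))"
    using nB k(2) x(1) by (intro mult_left_mono mult_mono) auto
  also have "\<dots> = 12288 * \<epsilon>\<^sup>2 * (8 * real N)"
    by (simp add: N_def power2_eq_square)
  also have "\<dots> \<le> 12288 * \<epsilon>\<^sup>2 * (8 * (4 * real L))"
    using NL by (intro mult_left_mono) auto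
  finally show ?thesis by simp
qed

theorem theorem3p1:
  "\<exists>c::real. c > 0 \<and>
     (\<forall>(n::nat) (\<epsilon>::real) (sk::sketch_alg) (est::estimate_alg).
        1 / sqrt (real n) < \<epsilon> \<longrightarrow> \<epsilon> < 1 \<longrightarrow> cut_sketch n \<epsilon> sk est \<longrightarrow>
        ereal_of_enat (worst_case_size n sk) \<ge> ereal (c * real n / \<epsilon>\<^sup>2))"
proof (intro exI[of _ "1 / (32 * 12288)"] conjI allI impI)
  fix n :: nat and \<epsilon> :: real and sk :: sketch_alg and est :: estimate_alg
  assume \<epsilon>: "1 / sqrt (real n) < \<epsilon>" "\<epsilon> < 1" and sk: "cut_sketch n \<epsilon> sk est"
  have \<epsilon>0: "0 < \<epsilon>" using \<epsilon>(1) by (rule le_less_trans[rotated]) simp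
  show "ereal (1 / (32 * 12288) * real n / \<epsilon>\<^sup>2) \<le> ereal_of_enat (worst_case_size n sk)"
  proof (cases "worst_case_size n sk")
    case (enat L)
    have L: "length (sk \<omega> E) \<le> L" if "E \<in> graphs_on n" "\<omega> \<in> space random_bits" for E \<omega>
    proof -
      have "enat (length (sk \<omega> E)) \<le> worst_case_size n sk"
        unfolding worst_case_size_def using that by (intro SUP_upper2[OF that(1)] SUP_upper)
      then show ?thesis by (simp add: enat)
    qed
    have "real n \<le> 32 * 12288 * \<epsilon>\<^sup>2 * real L"
    \<comment> \<open>Since \<open>1 / sqrt 0\<close> is 0 here, \<open>n = 0\<close> satisfies the
      hypotheses; the bound is then trivial.\<close>
    proof (cases "n = 0")
      case False
      then have n1: "1 < \<epsilon> * sqrt (real n)" using \<epsilon>(1) by (simp add: field_simps)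
      then have "1 \<le> (\<epsilon> * sqrt (real n))\<^sup>2" by (simp add: one_le_power)
      then have n: "1 \<le> real n * \<epsilon>\<^sup>2" by (simp add: power_mult_distrib mult.commute)
      show ?thesis
      proof (cases "3 * 12288 * \<epsilon>\<^sup>2 \<le> 1")
        case True
        show ?thesis by (rule sketch_length_small_eps[OF sk \<epsilon>0 True n L])
      next
        case big: False
        have "n \<noteq> 1" using \<epsilon> by auto
        with False have "n \<ge> 2" by simp
        from sketch_length_large_eps[OF sk \<epsilon>(2) this L]
        have "real n \<le> 6 * real L * 1" by simp
        \<comment> \<open>In this case \<epsilon> is bounded below, so the linear bound in
          \<open>L\<close> already has the required form, with 6 * 3 = 18 in place of 32.\<close>
        also have "\<dots> \<le> 6 * real L * (3 * 12288 * \<epsilon>\<^sup>2)"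
          using big by (intro mult_left_mono) auto
        also have "\<dots> = 18 * (12288 * \<epsilon>\<^sup>2 * real L)" by simp
        also have "\<dots> \<le> 32 * (12288 * \<epsilon>\<^sup>2 * real L)" by (intro mult_right_mono) auto
        finally show ?thesis by simp
      qed
    qed simp
    then show ?thesis
      using \<epsilon>0 by (simp add: enat field_simps)
  qed simp
qed simp

end
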